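(* Let $\varepsilon > 0$. Then there exists a Carleson measure $\mu$ on $\mathbb{R}^2_+$ with $\mathrm{Carl}(\mu) = 1$ and $$\|S^d_\mu\|_{\mathrm{BMO}} + \|S^d_\mu\|_{2} < \varepsilon,$$ where $S^d_\mu$ is the dyadic balayage of $\mu$ and $\|\cdot\|_2$ is the norm of $L^2(\mathbb{R})$.
   Context: $\mathbb{R}^2_+ = \{(x,y)\in\mathbb{R}^2 : y>0\}$ is the upper half-plane. Measures on $\mathbb{R}^2_+$ are positive regular Borel measures. For a bounded interval $I\subset\mathbb{R}$ of length $|I|>0$, the Carleson square is $Q_I=\{(x,y): x\in I,\ 0<y\le |I|\}$. $\mathcal{D}$ denotes the set of left-half-open dyadic intervals $(k2^n,(k+1)2^n]$, $k,n\in\mathbb{Z}$. For $I\in\mathcal{D}$, $T_I=\{(x,y): x\in I,\ |I|/2<y\le |I|\}$ is the top half of $Q_I$. A measure $\mu$ is a Carleson measure if there is a constant $C>0$ with $\mu(Q_I)\le C|I|$ for every interval $I\subset\mathbb{R}$ (equivalently, for every $I\in\mathcal{D}$). $\mathrm{Carl}(\mu)$ is the infimum of all $C>0$ such that $\mu(Q_I)\le C|I|$ for all $I\in\mathcal{D}$. The dyadic balayage of $\mu$ is the $[0,\infty]$-valued function $S^d_\mu(t)=\sum_{I\in\mathcal{D}}\frac{\chi_I(t)}{|I|}\mu(T_I)$, $t\in\mathbb{R}$. $\|b\|_{\mathrm{BMO}}=\sup_{I\subset\mathbb{R}\text{ interval}}\frac1{|I|}\int_I|b(t)-\langle b\rangle_I|\,dt$,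 the supremum being over all bounded intervals (not only dyadic ones), where $\langle b\rangle_I=\frac1{|I|}\int_I b(t)\,dt$. $\mathrm{BMO}(\mathbb{R})$ is the class of $b\in L^2(\mathbb{R})$ for which this is finite. *)

theory Defs
  imports "HOL-Analysis.Analysis"
begin

definition upper_half_plane :: "(real \<times> real) set" where
  "upper_half_plane = {(x, y). 0 < y}"

(* The half-plane is open in the plane, so relatively open (compact) subsets of it
   are just its subsets that are open (compact) in the plane. *)
definition regular_borel_measure_UHP :: "(real \<times> real) measure \<Rightarrow> bool" where
  "regular_borel_measure_UHP M \<longleftrightarrow>
     space M = upper_half_plane \<and>
     sets M = sets (restrict_space borel upper_half_plane) \<and>
     (\<forall>K. compact K \<and> K \<subseteq> upper_half_plane \<longrightarrow> emeasure M K < \<infinity>) \<and>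
     (\<forall>E\<in>sets M. emeasure M E =
        (INF V\<in>{V. open V \<and> E \<subseteq> V \<and> V \<subseteq> upper_half_plane}. emeasure M V)) \<and>
     (\<forall>E\<in>sets M. emeasure M E = (SUP K\<in>{K. compact K \<and> K \<subseteq> E}. emeasure M K))"

abbreviation len :: "real set \<Rightarrow> real" where
  "len I \<equiv> measure lborel I"

definition bounded_intervals :: "real set set" where
  "bounded_intervals = {I. is_interval I \<and> bounded I \<and> 0 < len I}"

definition dyadic_intervals :: "real set set" where
  "dyadic_intervals =
     {{of_int k * 2 powi n <.. of_int (k + 1) * 2 powi n} | (k::int) (n::int). True}"

definition carleson_square :: "real set \<Rightarrow> (real \<times> real) set" where
  "carleson_square I = {(x, y). x \<in> I \<and> 0 < y \<and> y \<le> len I}"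

definition top_half :: "real set \<Rightarrow> (real \<times> real) set" where
  "top_half I = {(x, y). x \<in> I \<and> len I / 2 < y \<and> y \<le> len I}"

definition carleson_measure :: "(real \<times> real) measure \<Rightarrow> bool" where
  "carleson_measure M \<longleftrightarrow>
     regular_borel_measure_UHP M \<and>
     (\<exists>C>0. \<forall>I\<in>bounded_intervals. emeasure M (carleson_square I) \<le> ennreal (C * len I))"

(* The value is infinity when no admissible constant exists. *)
definition Carl :: "(real \<times> real) measure \<Rightarrow> ennreal" where
  "Carl M =
     (INF C\<in>{C::real. 0 < C \<and>
        (\<forall>I\<in>dyadic_intervals. emeasure M (carleson_square I) \<le> ennreal (C * len I))}.
        ennreal C)"

(* Every family in ennreal is summable, so infsum is the genuine [0,infinity]-valued sum. *)
definition dyadic_balayage :: "(real \<times> real) measure \<Rightarrow> real \<Rightarrow> ennreal" where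
  "dyadic_balayage M t =
     (\<Sum>\<^sub>\<infinity>I\<in>dyadic_intervals. indicator I t / ennreal (len I) * emeasure M (top_half I))"

definition L2 :: "(real \<Rightarrow> real) set" where
  "L2 = {b. b \<in> borel_measurable lborel \<and> integrable lborel (\<lambda>t. (b t)\<^sup>2)}"

definition L2_norm :: "(real \<Rightarrow> real) \<Rightarrow> real" where
  "L2_norm b = sqrt (LINT t|lborel. (b t)\<^sup>2)"

definition average :: "(real \<Rightarrow> real) \<Rightarrow> real set \<Rightarrow> real" where
  "average b I = (LINT t:I|lborel. b t) / len I"

(* The averages are meaningful only for locally integrable b, which L2 membership
   ensures; the norm should be read together with membership in BMO below. *)
definition BMO_norm :: "(real \<Rightarrow> real) \<Rightarrow> ennreal" where
  "BMO_norm b =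
     (SUP I\<in>bounded_intervals.
        (\<integral>\<^sup>+t\<in>I. ennreal \<bar>b t - average b I\<bar> \<partial>lborel) / ennreal (len I))"

definition BMO :: "(real \<Rightarrow> real) set" where
  "BMO = {b \<in> L2. BMO_norm b < \<infinity>}"

end

(* Take the average f of the indicators of (-2^-j, 2^-j], n <= j < 2n. An interval is genuinely
   cut by many of these only if it is much longer than most of them, so f has BMO norm O(1/n);
   it is supported on a set of measure 2 * 2^-n, so its L^2 norm is small as well; yet f = 1 near 0.
   Since f is constant on dyadic intervals of length s = 2^-2n, carrying f(x) dx on the horizontal
   line y = s, which meets T_I only for |I| = s, gives a measure whose dyadic balayage is exactly f.
   Its Carleson constant is sup f = 1, as mu(Q_I) is either 0 or the integral of f over I. *)
theory Submission
  imports Defs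
begin

section \<open>Lengths of intervals and mean oscillation\<close>

lemma dist_le_len:
  assumes I: "is_interval I" "bounded I" and xy: "x \<in> I" "y \<in> I"
  shows "\<bar>x - y\<bar> \<le> len I"
proof -
  have fm: "I \<in> fmeasurable lborel"
    using real_interval_borel_measurable[OF I(1)] emeasure_bounded_finite[OF I(2)]
    by (simp add: fmeasurable_def)
  have le: "b - a \<le> len I" if "a \<in> I" "b \<in> I" "a \<le> b" for a b
  proof -
    have "{a..b} \<subseteq> I"
      using I(1) that(1,2) unfolding is_interval_1 atLeastAtMost_def by blast
    then have "len {a..b} \<le> len I"
      using fm by (intro measure_mono_fmeasurable) auto
    then show ?thesis using that by simp
  qed
  show ?thesis using le[OF xy] le[OF xy(2,1)] by linarith
qed

text \<open>Moving from the average to an arbitrary constant c at most doubles the oscillation: the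
  error |c - average| times |I| is the modulus of the integral of f - c over I, hence at most the
  integral of |f - c|. Oscillation can therefore be measured against whichever constant is
  convenient.\<close>

lemma mean_oscillation_le:
  assumes f: "set_integrable lborel I f" and I: "I \<in> sets borel" "bounded I" "0 < len I"
  shows "(\<integral>\<^sup>+t\<in>I. ennreal \<bar>f t - average f I\<bar> \<partial>lborel) \<le> 2 * (\<integral>\<^sup>+t\<in>I. ennreal \<bar>f t - c\<bar> \<partial>lborel)"
proof -
  have fin: "emeasure lborel I < \<infinity>" using I(2) by (rule emeasure_bounded_finite)
  then have eI: "emeasure lborel I = ennreal (len I)" by (simp add: emeasure_eq_ennreal_measure)
  have c: "set_integrable lborel I (\<lambda>_. c)"
    using fin I by (simp add: set_integrable_def)
  have fc: "set_integrable lborel I (\<lambda>t. f t - c)" using set_integral_diff(1)[OF f c] .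
  have [measurable]: "(\<lambda>t. indicator I t * f t) \<in> borel_measurable lborel"
    using f by (simp add: set_integrable_def borel_measurable_integrable)
  have [measurable]: "I \<in> sets lborel" using I by simp
  have "(LINT t:I|lborel. f t - c) = average f I * len I - c * len I"
    using set_integral_diff(2)[OF f c] I fin by (simp add: average_def set_lebesgue_integral_def)
  then have "ennreal (\<bar>c - average f I\<bar> * len I) = ennreal \<bar>LINT t:I|lborel. f t - c\<bar>"
    using I abs_mult[of "average f I - c" "len I"] by (simp add: left_diff_distrib abs_minus_commute)
  also have "\<dots> \<le> (\<integral>\<^sup>+t. ennreal \<bar>indicator I t * (f t - c)\<bar> \<partial>lborel)"
    using integral_norm_bound_ennreal[OF fc[unfolded set_integrable_def]]
    by (simp add: set_lebesgue_integral_def)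
  also have "\<dots> = (\<integral>\<^sup>+t\<in>I. ennreal \<bar>f t - c\<bar> \<partial>lborel)"
    by (intro nn_integral_cong) (simp split: split_indicator)
  finally have *: "ennreal (\<bar>c - average f I\<bar> * len I) \<le> (\<integral>\<^sup>+t\<in>I. ennreal \<bar>f t - c\<bar> \<partial>lborel)" .
  \<comment> \<open>Triangle inequality through c. The indicator is moved inside the modulus because
    f is known to be measurable only after multiplication by the indicator of I.\<close>
  have "(\<integral>\<^sup>+t\<in>I. ennreal \<bar>f t - average f I\<bar> \<partial>lborel)
    \<le> (\<integral>\<^sup>+t. ennreal \<bar>indicator I t * f t - c * indicator I t\<bar> + ennreal \<bar>c - average f I\<bar> * indicator I t \<partial>lborel)"
    by (intro nn_integral_mono) (auto split: split_indicator simp flip: ennreal_plus)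
  also have "\<dots> = (\<integral>\<^sup>+t. ennreal \<bar>indicator I t * f t - c * indicator I t\<bar> \<partial>lborel)
      + ennreal (\<bar>c - average f I\<bar> * len I)"
    by (subst nn_integral_add) (auto simp: nn_integral_cmult_indicator eI ennreal_mult I(1))
  also have "(\<integral>\<^sup>+t. ennreal \<bar>indicator I t * f t - c * indicator I t\<bar> \<partial>lborel) =
      (\<integral>\<^sup>+t\<in>I. ennreal \<bar>f t - c\<bar> \<partial>lborel)"
    by (intro nn_integral_cong) (auto split: split_indicator)
  finally show ?thesis using * by (simp add: mult_2 add_left_mono order_trans)
qed

section \<open>The nested intervals around 0 and their overlap with a given interval\<close>

text \<open>Left-open and right-closed like the dyadic intervals, so that each one is a union of
  dyadic intervals of any length 2^-N with N >= j.\<close>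

definition nested :: "nat \<Rightarrow> real set" where
  "nested j = {- ((1/2)^j)<..(1/2)^j}"

lemma nested_antimono:
  assumes "j \<le> k"
  shows "nested k \<subseteq> nested j"
proof -
  have "(1/2::real)^k \<le> (1/2)^j" using assms by (intro power_decreasing) auto
  then show ?thesis unfolding nested_def Ioc_subset_iff by simp
qed

lemma sum_half_power_le: "(\<Sum>j\<in>{k<..m}. (1/2::real)^j) \<le> (1/2)^k"
proof -
  have "k \<le> m \<Longrightarrow> (\<Sum>j\<in>{k<..m}. (1/2::real)^j) = (1/2)^k - (1/2)^m"
  proof (induction m rule: dec_induct)
    case (step m)
    have "{k<..Suc m} = insert (Suc m) {k<..m}" using step by auto
    then show ?case using step by simp
  qed simp
  then show ?thesis by (cases "k \<le> m") auto
qed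

lemma len_nested_Int_le:
  assumes "is_interval I" "bounded I"
  shows "len (nested j \<inter> I) \<le> 2 * (1/2)^j" "len (nested j \<inter> I) \<le> len I"
proof -
  have m: "I \<in> sets borel" using assms by (simp add: real_interval_borel_measurable)
  have "len (nested j \<inter> I) \<le> len (nested j)"
    using m by (intro measure_mono_fmeasurable) (auto simp: nested_def fmeasurable_def)
  then show "len (nested j \<inter> I) \<le> 2 * (1/2)^j" by (simp add: nested_def)
  show "len (nested j \<inter> I) \<le> len I"
    using m emeasure_bounded_finite[OF assms(2)]
    by (intro measure_mono_fmeasurable) (auto simp: nested_def fmeasurable_def)
qed

(* The largest cut interval contributes at most |I|; the ends of the others lie at distance
   at most 2|I| from 0, so they form a geometric series. *)
lemma sum_cut_nested_le:
  assumes I: "is_interval I" "bounded I" and "finite A"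
    and cut: "\<And>j. j \<in> A \<Longrightarrow> nested j \<inter> I \<noteq> {} \<and> \<not> I \<subseteq> nested j"
  shows "(\<Sum>j\<in>A. len (nested j \<inter> I)) \<le> 5 * len I"
proof (cases "A = {}")
  case False
  define k where "k = Min A"
  have k: "k \<in> A" "\<And>j. j \<in> A \<Longrightarrow> k \<le> j" using False \<open>finite A\<close> by (auto simp: k_def)
  have rest: "(\<Sum>j\<in>A - {k}. len (nested j \<inter> I)) \<le> 4 * len I"
  proof (cases "A - {k} = {}")
    case False
    then obtain j where j: "j \<in> A" "k < j" using k by (metis Diff_eq_empty_iff le_neq_implies_less singleton_iff subsetI)
    obtain x where x: "x \<in> I" "x \<in> nested j" using cut[OF j(1)] by auto
    obtain y where y: "y \<in> I" "y \<notin> nested k" using cut[OF k(1)] by auto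
    \<comment> \<open>Since j > k, the point x has modulus at most half of 2^-k, whereas y, lying
      outside \<open>nested k\<close>, has modulus at least 2^-k. Hence x and y are at least 2^-k /
      2 apart, and both belong to I.\<close>
    have "(1/2::real)^j \<le> (1/2)^Suc k" using j by (intro power_decreasing) auto
    then have "(1/2)^k \<le> 2 * \<bar>x - y\<bar>" using x(2) y(2) by (auto simp: nested_def)
    also have "\<dots> \<le> 2 * len I" using dist_le_len[OF I x(1) y(1)] by simp
    finally have L: "(1/2)^k \<le> 2 * len I" .
    have "(\<Sum>j\<in>A - {k}. len (nested j \<inter> I)) \<le> (\<Sum>j\<in>A - {k}. 2 * (1/2)^j)"
      by (intro sum_mono len_nested_Int_le I)
    also have "\<dots> \<le> (\<Sum>j\<in>{k<..Max A}. 2 * (1/2)^j)"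
      using k \<open>finite A\<close> by (intro sum_mono2) (auto simp: order.strict_iff_order)
    also have "\<dots> \<le> 2 * (1/2)^k"
      using sum_half_power_le[of k "Max A"] by (simp flip: sum_distrib_left)
    finally show ?thesis using L by simp
  qed (simp only: sum.empty, simp)
  have "(\<Sum>j\<in>A. len (nested j \<inter> I)) = len (nested k \<inter> I) + (\<Sum>j\<in>A - {k}. len (nested j \<inter> I))"
    using k \<open>finite A\<close> by (simp add: sum.remove)
  also have "len (nested k \<inter> I) \<le> len I" by (rule len_nested_Int_le[OF I])
  finally show ?thesis using rest by simp
qed simp

section \<open>The staircase function and its L^2 and BMO norms\<close>

text \<open>A discretised, truncated logarithm scaled by 1/n: moving towards 0, it climbs by 1/n at
  each dyadic scale, from 0 outside \<open>nested n\<close> to 1 (for n > 0) once every summand is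
  active. The logarithm has bounded mean oscillation, so the scaling leaves a BMO norm of order 1/n
  although the height is 1.\<close>

definition staircase :: "nat \<Rightarrow> real \<Rightarrow> real" where
  "staircase n t = (\<Sum>j=n..<2*n. indicator (nested j) t) / n"

lemma sets_nested [measurable]: "nested j \<in> sets borel" by (simp add: nested_def)

lemma staircase_measurable [measurable]: "staircase n \<in> borel_measurable borel"
  unfolding staircase_def by measurable

lemma staircase_nonneg: "0 \<le> staircase n t"
  by (simp add: staircase_def sum_nonneg)

lemma staircase_le: "staircase n t \<le> indicator (nested n) t"
proof -
  have "(\<Sum>j=n..<2*n. indicator (nested j) t) \<le> (\<Sum>j=n..<2*n. indicator (nested n) t :: real)"
  proof (intro sum_mono)
    fix j assume "j \<in> {n..<2*n}"
    then show "indicator (nested j) t \<le> (indicator (nested n) t :: real)"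
      using nested_antimono[of n j] by (auto simp: indicator_def)
  qed
  \<comment> \<open>For n = 0 the quotient is 0 by the convention on division by zero.\<close>
  then show ?thesis
    by (cases "n = 0") (auto simp: staircase_def divide_simps mult.commute)
qed

lemma staircase_le_1: "staircase n t \<le> 1"
  by (rule order_trans[OF staircase_le]) simp

text \<open>Provides a whole dyadic interval, (0, 2^-2n], at full height; the lower bound for the
  Carleson constant is tested there.\<close>

lemma staircase_eq_1:
  assumes "0 < n" "0 < t" "t \<le> (1/2)^(2*n)"
  shows "staircase n t = 1"
proof -
  have "- ((1/2)^(2*n)) < (0::real)" by simp
  then have "t \<in> nested (2*n)" using assms by (auto simp: nested_def simp del: neg_less_0_iff_less)
  then have "t \<in> nested j" if "j \<in> {n..<2*n}" for j
    using that nested_antimono[of j "2*n"] by auto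
  then show ?thesis using assms by (simp add: staircase_def)
qed

lemma integrable_staircase: "integrable lborel (staircase n)"
proof (rule Bochner_Integration.integrable_bound)
  show "integrable lborel (indicator (nested n) :: real \<Rightarrow> real)"
    by (simp add: nested_def)
  show "AE t in lborel. norm (staircase n t) \<le> norm (indicator (nested n) t :: real)"
    using staircase_le[of n] staircase_nonneg[of n] by simp
qed simp

lemma staircase_square_le: "(staircase n t)\<^sup>2 \<le> indicator (nested n) t"
proof -
  have "(staircase n t)\<^sup>2 \<le> staircase n t * 1"
    unfolding power2_eq_square by (intro mult_left_mono staircase_le_1 staircase_nonneg)
  then show ?thesis using staircase_le[of n t] by simp
qed

lemma integrable_staircase_square: "integrable lborel (\<lambda>t. (staircase n t)\<^sup>2)"
proof (rule Bochner_Integration.integrable_bound)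
  show "integrable lborel (indicator (nested n) :: real \<Rightarrow> real)"
    by (simp add: nested_def)
qed (use staircase_square_le[of n] in auto)

lemma L2_norm_staircase_le: "L2_norm (staircase n) \<le> sqrt (2 * (1/2)^n)"
proof -
  have "(LINT t|lborel. (staircase n t)\<^sup>2) \<le> (LINT t|lborel. indicator (nested n) t)"
    by (intro integral_mono integrable_staircase_square staircase_square_le) (simp add: nested_def)
  also have "\<dots> = 2 * (1/2)^n" by (simp add: nested_def)
  finally show ?thesis by (simp add: L2_norm_def)
qed

text \<open>On I, every summand that is not cut by I is constant, so the staircase differs from a
  constant only by the cut summands. These have total integral at most 5|I| before division by n,
  and passing from that constant to the average doubles the bound to 10/n.\<close>

lemma BMO_norm_staircase_le:
  assumes "0 < n"
  shows "BMO_norm (staircase n) \<le> ennreal (10 / n)"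
  unfolding BMO_norm_def
proof (rule SUP_least)
  fix I assume "I \<in> bounded_intervals"
  then have I: "is_interval I" "bounded I" "0 < len I" by (auto simp: bounded_intervals_def)
  have [measurable]: "I \<in> sets borel" using I by (simp add: real_interval_borel_measurable)
  have int: "integrable lborel (indicator (nested j \<inter> I) :: real \<Rightarrow> real)" for j
    using emeasure_bounded_finite[of "nested j \<inter> I"] I by (simp add: bounded_Int)
  \<comment> \<open>A collects the cut indices and B those whose summand is identically 1 on I. The
    remaining indices have \<open>nested j\<close> disjoint from I and contribute 0 there, so
    \<open>card B / n\<close> is the constant to compare with.\<close>
  define A where "A = {j\<in>{n..<2*n}. nested j \<inter> I \<noteq> {} \<and> \<not> I \<subseteq> nested j}"
  define B where "B = {j\<in>{n..<2*n}. nested j \<inter> I \<noteq> {} \<and> I \<subseteq> nested j}"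
  have cut: "(\<Sum>j\<in>A. len (nested j \<inter> I)) \<le> 5 * len I"
    by (rule sum_cut_nested_le[OF I(1,2)]) (auto simp: A_def)
  have diff: "\<bar>staircase n t - card B / n\<bar> = (\<Sum>j\<in>A. indicator (nested j \<inter> I) t) / n" if "t \<in> I" for t
  proof -
    have "(\<Sum>j=n..<2*n. indicator (nested j) t :: real) = (\<Sum>j\<in>A \<union> B. indicator (nested j) t)"
      using that by (intro sum.mono_neutral_right) (auto simp: A_def B_def indicator_def)
    also have "\<dots> = (\<Sum>j\<in>A. indicator (nested j) t) + (\<Sum>j\<in>B. indicator (nested j) t)"
      by (intro sum.union_disjoint) (auto simp: A_def B_def)
    also have "(\<Sum>j\<in>B. indicator (nested j) t :: real) = (\<Sum>j\<in>B. 1)"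
      using that by (intro sum.cong) (auto simp: B_def indicator_def)
    also have "(\<Sum>j\<in>A. indicator (nested j) t :: real) = (\<Sum>j\<in>A. indicator (nested j \<inter> I) t)"
      using that by (intro sum.cong) (auto simp: indicator_def)
    finally show ?thesis by (simp add: staircase_def add_divide_distrib sum_nonneg)
  qed
  have "(\<integral>\<^sup>+t\<in>I. ennreal \<bar>staircase n t - card B / n\<bar> \<partial>lborel) \<le>
      (\<integral>\<^sup>+t. ennreal ((\<Sum>j\<in>A. indicator (nested j \<inter> I) t) / n) \<partial>lborel)"
    by (intro nn_integral_mono) (auto simp: diff split: split_indicator)
  also have "\<dots> = ennreal (LINT t|lborel. (\<Sum>j\<in>A. indicator (nested j \<inter> I) t) / n)"
    by (intro nn_integral_eq_integral AE_I2 Bochner_Integration.integrable_divide_zero Bochner_Integration.integrable_sum)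
      (auto simp: sum_nonneg int)
  also have "(LINT t|lborel. (\<Sum>j\<in>A. indicator (nested j \<inter> I) t) / n) = (\<Sum>j\<in>A. len (nested j \<inter> I)) / n"
    by (simp add: int)
  also have "ennreal \<dots> \<le> ennreal (5 * len I / n)"
    by (intro ennreal_leI divide_right_mono cut) auto
  finally have bound: "(\<integral>\<^sup>+t\<in>I. ennreal \<bar>staircase n t - card B / n\<bar> \<partial>lborel) \<le> ennreal (5 * len I / n)" .
  have "set_integrable lborel I (staircase n)"
    unfolding set_integrable_def by (intro integrable_mult_indicator integrable_staircase) simp
  then have "(\<integral>\<^sup>+t\<in>I. ennreal \<bar>staircase n t - average (staircase n) I\<bar> \<partial>lborel)
    \<le> 2 * (\<integral>\<^sup>+t\<in>I. ennreal \<bar>staircase n t - card B / n\<bar> \<partial>lborel)"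
    using I by (intro mean_oscillation_le) auto
  also have "\<dots> \<le> 2 * ennreal (5 * len I / n)"
    by (intro mult_left_mono bound) simp
  also have "\<dots> = ennreal (10 / n) * ennreal (len I)"
    using ennreal_mult'[of 2 "5 * len I / n"] by (simp flip: ennreal_mult')
  finally show "(\<integral>\<^sup>+t\<in>I. ennreal \<bar>staircase n t - average (staircase n) I\<bar> \<partial>lborel) / ennreal (len I)
    \<le> ennreal (10 / n)"
    using I by (intro divide_le_posI_ennreal) (auto simp: mult.commute)
qed

section \<open>Measures carried by a horizontal line\<close>

text \<open>The measure g(x) dx placed at height s. For s > 0 the restriction loses no mass; it
  makes the half-plane the underlying space.\<close>

definition horizontal_measure :: "(real \<Rightarrow> ennreal) \<Rightarrow> real \<Rightarrow> (real \<times> real) measure" where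
  "horizontal_measure g s =
     restrict_space (distr (density lborel g) borel (\<lambda>x. (x, s))) upper_half_plane"

lemma open_upper_half_plane: "open upper_half_plane"
proof -
  have "open {p :: real \<times> real. 0 < snd p}" by (intro open_Collect_less continuous_intros)
  then show ?thesis by (simp add: upper_half_plane_def case_prod_beta')
qed

lemma emeasure_distr_horizontal:
  fixes g :: "real \<Rightarrow> ennreal" and s :: real
  assumes [measurable]: "g \<in> borel_measurable borel" "A \<in> sets borel"
  shows "emeasure (distr (density lborel g) borel (\<lambda>x. (x, s))) A =
    (\<integral>\<^sup>+x. g x * indicator A (x, s) \<partial>lborel)"
proof -
  have m [measurable]: "(\<lambda>x::real. (x, s)) \<in> borel \<rightarrow>\<^sub>M borel"
    by (intro borel_measurable_continuous_onI continuous_intros)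
  have [measurable]: "(\<lambda>x. (x, s)) -` A \<in> sets borel"
    using measurable_sets[OF m, of A] by simp
  show ?thesis
    by (simp add: emeasure_distr emeasure_density indicator_vimage[symmetric])
       (auto intro!: nn_integral_cong split: split_indicator)
qed

lemma emeasure_horizontal_measure:
  assumes "g \<in> borel_measurable borel" "A \<in> sets borel" "A \<subseteq> upper_half_plane"
  shows "emeasure (horizontal_measure g s) A = (\<integral>\<^sup>+x. g x * indicator A (x, s) \<partial>lborel)"
  using assms unfolding horizontal_measure_def
  by (subst emeasure_restrict_space) (auto simp: emeasure_distr_horizontal open_upper_half_plane)

text \<open>Finite Borel measures on the plane are regular, and this passes to the half-plane: being
  open, it can be intersected with each open superset of E, and compact subsets of E already lie in
  it.\<close>

lemma regular_horizontal_measure: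
  assumes g: "g \<in> borel_measurable borel" and fin: "(\<integral>\<^sup>+x. g x \<partial>lborel) < \<infinity>"
  shows "regular_borel_measure_UHP (horizontal_measure g s)"
proof -
  let ?N = "distr (density lborel g) borel (\<lambda>x. (x, s))" and ?M = "horizontal_measure g s"
  have sets_N: "sets ?N = sets borel" by simp
  have fin_N: "emeasure ?N (space ?N) \<noteq> \<infinity>"
    using fin emeasure_distr_horizontal[OF g, of UNIV s] by simp
  have sets_M: "E \<in> sets ?M \<longleftrightarrow> E \<in> sets borel \<and> E \<subseteq> upper_half_plane" for E
    by (auto simp: horizontal_measure_def sets_restrict_space_iff open_upper_half_plane)
  have eq: "emeasure ?M E = emeasure ?N E" if "E \<subseteq> upper_half_plane" for E
    unfolding horizontal_measure_def using that
    by (intro emeasure_restrict_space) (auto simp: open_upper_half_plane)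
  show ?thesis unfolding regular_borel_measure_UHP_def
  proof (intro conjI allI impI ballI)
    show "space ?M = upper_half_plane" by (simp add: horizontal_measure_def space_restrict_space)
    show "sets ?M = sets (restrict_space borel upper_half_plane)"
      unfolding horizontal_measure_def by (intro sets_restrict_space_cong) simp
  next
    fix K assume K: "compact K \<and> K \<subseteq> upper_half_plane"
    then have "emeasure ?M K \<le> emeasure ?N (space ?N)" using emeasure_space[of ?N K] by (simp add: eq)
    then show "emeasure ?M K < \<infinity>" using fin_N by (simp add: less_top top_unique)
  next
    fix E assume "E \<in> sets ?M"
    then have E: "E \<in> sets borel" "E \<subseteq> upper_half_plane" by (auto simp: sets_M)
    have "emeasure ?M E = (INF V\<in>{V. E \<subseteq> V \<and> open V}. emeasure ?N V)"
      using outer_regular[OF sets_N fin_N E(1)] by (simp add: eq E)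
    also have "\<dots> = (INF V\<in>{V. open V \<and> E \<subseteq> V \<and> V \<subseteq> upper_half_plane}. emeasure ?M V)"
    proof (intro antisym INF_greatest)
      fix V assume "V \<in> {V. E \<subseteq> V \<and> open V}"
      then show "(INF V\<in>{V. open V \<and> E \<subseteq> V \<and> V \<subseteq> upper_half_plane}. emeasure ?M V) \<le> emeasure ?N V"
        using E open_upper_half_plane
        by (intro INF_lower2[of "V \<inter> upper_half_plane"]) (auto simp: eq intro!: emeasure_mono)
    qed (auto simp: eq intro!: INF_lower)
    finally show "emeasure ?M E = (INF V\<in>{V. open V \<and> E \<subseteq> V \<and> V \<subseteq> upper_half_plane}. emeasure ?M V)" .
    have "emeasure ?M E = (SUP K\<in>{K. K \<subseteq> E \<and> compact K}. emeasure ?N K)"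
      using inner_regular[OF sets_N fin_N E(1)] by (simp add: eq E)
    also have "\<dots> = (SUP K\<in>{K. compact K \<and> K \<subseteq> E}. emeasure ?M K)"
      using E by (intro SUP_cong) (auto simp: eq)
    finally show "emeasure ?M E = (SUP K\<in>{K. compact K \<and> K \<subseteq> E}. emeasure ?M K)" .
  qed
qed

lemma emeasure_carleson_square_horizontal:
  assumes "g \<in> borel_measurable borel" "I \<in> sets borel" "0 < s"
  shows "emeasure (horizontal_measure g s) (carleson_square I) =
    (if s \<le> len I then \<integral>\<^sup>+x\<in>I. g x \<partial>lborel else 0)"
proof -
  have "carleson_square I = I \<times> {0<..len I}" by (auto simp: carleson_square_def)
  then have "carleson_square I \<in> sets borel" using assms by (simp add: borel_prod[symmetric])
  moreover have "carleson_square I \<subseteq> upper_half_plane"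
    by (auto simp: carleson_square_def upper_half_plane_def)
  ultimately show ?thesis using assms
    by (auto simp: emeasure_horizontal_measure carleson_square_def indicator_def intro!: nn_integral_cong)
qed

lemma emeasure_top_half_horizontal:
  assumes "g \<in> borel_measurable borel" "I \<in> sets borel"
  shows "emeasure (horizontal_measure g s) (top_half I) =
    (if len I / 2 < s \<and> s \<le> len I then \<integral>\<^sup>+x\<in>I. g x \<partial>lborel else 0)"
proof -
  have "top_half I = I \<times> {len I / 2<..len I}" by (auto simp: top_half_def)
  then have "top_half I \<in> sets borel" using assms by (simp add: borel_prod[symmetric])
  moreover have "top_half I \<subseteq> upper_half_plane"
    using measure_nonneg[of lborel I] by (auto simp: top_half_def upper_half_plane_def simp del: measure_nonneg)
  ultimately show ?thesis using assms
    by (auto simp: emeasure_horizontal_measure top_half_def indicator_def intro!: nn_integral_cong)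
qed

section \<open>Dyadic balayage of a measure on a line of dyadic height\<close>

lemma len_dyadic: "len {of_int k * 2 powi n <.. of_int (k + 1) * 2 powi n} = 2 powi n"
  by (simp add: algebra_simps)

text \<open>The line at height 2^m meets only the top halves of dyadic intervals of length 2^m, and
  these intervals are disjoint. The sum thus collapses to the term of the one containing t, which is
  the average of g over it.\<close>

lemma dyadic_balayage_horizontal:
  fixes m k :: int
  defines "J \<equiv> {of_int k * 2 powi m <.. of_int (k + 1) * 2 powi m}"
  assumes g: "g \<in> borel_measurable borel" and t: "t \<in> J"
  shows "dyadic_balayage (horizontal_measure g (2 powi m)) t =
    (\<integral>\<^sup>+x\<in>J. g x \<partial>lborel) / ennreal (2 powi m)"
proof -
  let ?M = "horizontal_measure g (2 powi m)"
  let ?F = "\<lambda>I. indicator I t / ennreal (len I) * emeasure ?M (top_half I)"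
  have J: "J \<in> dyadic_intervals" "J \<in> sets borel" "len J = 2 powi m"
    by (auto simp: J_def dyadic_intervals_def len_dyadic simp del: of_int_add)
  have zero: "?F I = 0" if "I \<in> dyadic_intervals" "I \<noteq> J" for I
  proof (rule ccontr)
    assume nz: "?F I \<noteq> 0"
    obtain k' n where I: "I = {of_int k' * 2 powi n <.. of_int (k' + 1) * 2 powi n}"
      using \<open>I \<in> dyadic_intervals\<close> by (auto simp: dyadic_intervals_def)
    then have [measurable]: "I \<in> sets borel" by simp
    have lI: "len I = 2 powi n" unfolding I by (rule len_dyadic)
    have tI: "t \<in> I" using nz by (auto split: split_indicator_asm)
    have "(2::real) powi n / 2 < 2 powi m" "(2::real) powi m \<le> 2 powi n"
      using nz by (auto simp: emeasure_top_half_horizontal[OF g] lI split: if_splits)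
    \<comment> \<open>Comparing exponents gives n - 1 < m <= n, which determines the length of
      I.\<close>
    then have "(2::real) powi (n - 1) < 2 powi m" "(2::real) powi m \<le> 2 powi n"
      by (auto simp: power_int_diff)
    then have "\<not> m \<le> n - 1" "\<not> n < m"
      using power_int_increasing[of m "n - 1" "2::real"] power_int_strict_increasing[of n m "2::real"]
      by auto
    then have mn: "m = n" by simp
    define s where "s = (2::real) powi m"
    have s: "s > 0" by (simp add: s_def)
    \<comment> \<open>Two intervals of the same generation share the point t, so k < k' + 1 and k' <
      k + 1, which forces k = k'.\<close>
    have "of_int k * s < t" "t \<le> of_int (k + 1) * s" "of_int k' * s < t" "t \<le> of_int (k' + 1) * s"
      using t tI by (auto simp: I J_def mn s_def)
    then have "of_int k * s < of_int (k' + 1) * s" "of_int k' * s < of_int (k + 1) * s"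
      by linarith+
    then have "k = k'" using s by (simp only: mult_less_cancel_right_pos of_int_less_iff)
    then show False using \<open>I \<noteq> J\<close> by (simp add: I J_def mn)
  qed
  have "dyadic_balayage ?M t = infsum ?F {J}"
    unfolding dyadic_balayage_def using J zero by (intro infsum_cong_neutral) auto
  also have "\<dots> = (\<integral>\<^sup>+x\<in>J. g x \<partial>lborel) / ennreal (2 powi m)"
    using t J by (simp add: emeasure_top_half_horizontal[OF g] ennreal_divide_times mult.commute divide_ennreal_def)
  finally show ?thesis .
qed

section \<open>Constancy of the staircase on short dyadic intervals\<close>

text \<open>The ends of \<open>nested j\<close> are integer multiples of 2^-N, so no dyadic interval
  of length 2^-N is split by it. The criterion depends on k alone, so all points of such an interval
  give the same answer.\<close>

lemma mem_nested_iff: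
  assumes "j \<le> N" and x: "x \<in> {of_int k * 2 powi (- int N)<..of_int (k + 1) * 2 powi (- int N)}"
  shows "x \<in> nested j \<longleftrightarrow> - (2 ^ (N - j)) \<le> k \<and> k < 2 ^ (N - j)"
proof -
  define s where "s = (2::real) powi (- int N)"
  define a :: int where "a = 2 ^ (N - j)"
  have s: "0 < s" by (simp add: s_def)
  have a: "(1/2)^j = of_int a * s"
  proof -
    have "(2::real)^N = 2^(N - j) * 2^j" using assms(1) by (simp flip: power_add)
    then show ?thesis by (simp add: a_def s_def power_int_minus field_simps)
  qed
  have x: "of_int k * s < x" "x \<le> of_int (k + 1) * s" using x by (auto simp: s_def)
  have lt: "b < c" if "of_int b * s < of_int c * s" for b c :: int
    using that s by (simp only: mult_less_cancel_right_pos of_int_less_iff)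
  have le: "of_int b * s \<le> of_int c * s" if "b \<le> c" for b c :: int
    using that s by (intro mult_right_mono) auto
  \<comment> \<open>Because x lies in (k s, (k + 1) s], the upper condition amounts to k + 1 <= a
    and the lower one to -a < k + 1. The half-open ends of both families match exactly.\<close>
  have "x \<le> of_int a * s \<longleftrightarrow> k < a"
    using lt[of k a] le[of "k + 1" a] x by fastforce
  moreover have "of_int (- a) * s < x \<longleftrightarrow> - a \<le> k"
    using lt[of "- a" "k + 1"] le[of "- a" k] x by fastforce
  ultimately show ?thesis by (auto simp: nested_def a simp flip: a_def)
qed

lemma staircase_eq:
  assumes "x \<in> {of_int k * 2 powi (- int (2 * n))<..of_int (k + 1) * 2 powi (- int (2 * n))}"
    and "t \<in> {of_int k * 2 powi (- int (2 * n))<..of_int (k + 1) * 2 powi (- int (2 * n))}"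
  shows "staircase n x = staircase n t"
proof -
  have "x \<in> nested j \<longleftrightarrow> t \<in> nested j" if "j \<in> {n..<2*n}" for j
    using mem_nested_iff[OF _ assms(1), of j] mem_nested_iff[OF _ assms(2), of j] that by simp
  then show ?thesis unfolding staircase_def
    by (intro arg_cong2[of _ _ _ _ "(/)"] sum.cong) (auto simp: indicator_def)
qed

section \<open>The measure, its balayage and its Carleson constant\<close>

text \<open>The height 2^-2n is a dyadic length so short that the staircase is constant on dyadic
  intervals of that length. Averaging over them therefore returns the staircase itself.\<close>

definition staircase_measure :: "nat \<Rightarrow> (real \<times> real) measure" where
  "staircase_measure n = horizontal_measure (\<lambda>x. ennreal (staircase n x)) (2 powi (- int (2 * n)))"

lemma dyadic_balayage_staircase_measure:
  "dyadic_balayage (staircase_measure n) t = ennreal (staircase n t)"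
proof -
  define m where "m = - int (2 * n)"
  \<comment> \<open>The ceiling minus one, rather than the floor, indexes the left-open interval
    that contains t.\<close>
  define k where "k = \<lceil>t / 2 powi m\<rceil> - 1"
  define J where "J = {of_int k * (2::real) powi m<..of_int (k + 1) * 2 powi m}"
  have "of_int k < t / 2 powi m" "t / 2 powi m \<le> of_int (k + 1)"
    unfolding k_def by linarith+
  then have t: "t \<in> J" by (simp add: J_def pos_less_divide_eq pos_divide_le_eq)
  have "dyadic_balayage (staircase_measure n) t =
    (\<integral>\<^sup>+x\<in>J. ennreal (staircase n x) \<partial>lborel) / ennreal (2 powi m)"
    using t unfolding staircase_measure_def J_def m_def
    by (intro dyadic_balayage_horizontal) auto
  also have "(\<integral>\<^sup>+x\<in>J. ennreal (staircase n x) \<partial>lborel) = (\<integral>\<^sup>+x\<in>J. ennreal (staircase n t) \<partial>lborel)"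
  proof (rule nn_integral_cong)
    fix x :: real
    show "ennreal (staircase n x) * indicator J x = ennreal (staircase n t) * indicator J x"
      using t staircase_eq[of x k n t] unfolding J_def m_def by (cases "x \<in> J") (auto simp: J_def m_def)
  qed
  also have "\<dots> = ennreal (staircase n t) * ennreal (2 powi m)"
    by (simp add: nn_integral_cmult_indicator J_def algebra_simps)
  also have "\<dots> / ennreal (2 powi m) = ennreal (staircase n t)"
    by (simp add: divide_ennreal staircase_nonneg flip: ennreal_mult)
  finally show ?thesis .
qed

lemma emeasure_carleson_square_staircase_measure:
  assumes "I \<in> sets borel"
  shows "emeasure (staircase_measure n) (carleson_square I) =
    (if 2 powi (- int (2 * n)) \<le> len I then \<integral>\<^sup>+x\<in>I. ennreal (staircase n x) \<partial>lborel else 0)"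
  unfolding staircase_measure_def using assms by (intro emeasure_carleson_square_horizontal) auto

text \<open>Follows from the density being at most 1. It serves both the Carleson condition over all
  bounded intervals and the upper bound for \<open>Carl\<close>.\<close>

lemma emeasure_carleson_square_staircase_measure_le:
  assumes "is_interval I" "bounded I"
  shows "emeasure (staircase_measure n) (carleson_square I) \<le> ennreal (len I)"
proof -
  have I: "I \<in> sets borel" using assms by (simp add: real_interval_borel_measurable)
  have "(\<integral>\<^sup>+x\<in>I. ennreal (staircase n x) \<partial>lborel) \<le> (\<integral>\<^sup>+x. indicator I x \<partial>lborel)"
    using staircase_le_1 by (intro nn_integral_mono) (auto split: split_indicator)
  also have "\<dots> = ennreal (len I)"
    using I emeasure_bounded_finite[OF assms(2)] by (simp add: emeasure_eq_ennreal_measure)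
  finally show ?thesis using I by (simp add: emeasure_carleson_square_staircase_measure)
qed

lemma carleson_measure_staircase_measure: "carleson_measure (staircase_measure n)"
  unfolding carleson_measure_def
proof (intro conjI exI[of _ 1] ballI)
  have "(\<integral>\<^sup>+x. ennreal (staircase n x) \<partial>lborel) < \<infinity>"
    using integrable_staircase[of n] by (simp add: nn_integral_eq_integral staircase_nonneg)
  then show "regular_borel_measure_UHP (staircase_measure n)"
    unfolding staircase_measure_def by (intro regular_horizontal_measure) auto
qed (auto simp: bounded_intervals_def emeasure_carleson_square_staircase_measure_le)

text \<open>The constant 1 is admissible because the density is at most 1. No smaller one is,
  because the square over (0, 2^-2n] reaches the line and the density equals 1 above this interval,
  so its mass is exactly its length.\<close>

lemma Carl_staircase_measure:
  assumes "0 < n"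
  shows "Carl (staircase_measure n) = 1"
  unfolding Carl_def
proof (intro antisym INF_greatest)
  have "is_interval I \<and> bounded I" if "I \<in> dyadic_intervals" for I
    using that by (auto simp: dyadic_intervals_def is_interval_oc)
  then show "(INF C\<in>{C. 0 < C \<and> (\<forall>I\<in>dyadic_intervals. emeasure (staircase_measure n) (carleson_square I)
      \<le> ennreal (C * len I))}. ennreal C) \<le> 1"
    by (intro INF_lower2[of 1]) (auto intro: emeasure_carleson_square_staircase_measure_le)
next
  fix C assume C: "C \<in> {C. 0 < C \<and> (\<forall>I\<in>dyadic_intervals. emeasure (staircase_measure n) (carleson_square I)
      \<le> ennreal (C * len I))}"
  define m where "m = - int (2 * n)"
  \<comment> \<open>This is (0, 2^-2n], written with k = 0 so that it matches the form of the dyadic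
    intervals literally.\<close>
  define I where "I = {of_int 0 * 2 powi m <.. of_int (0 + 1) * (2::real) powi m}"
  have I: "I \<in> dyadic_intervals" unfolding I_def dyadic_intervals_def by blast
  have lI: "len I = 2 powi m" unfolding I_def by (rule len_dyadic)
  have m: "(2::real) powi m = (1/2)^(2*n)"
    by (simp only: m_def power_int_minus power_int_of_nat power_one_over inverse_eq_divide)
  have "ennreal (2 powi m) = (\<integral>\<^sup>+x. indicator I x \<partial>lborel)" by (simp add: I_def)
  also have "\<dots> = (\<integral>\<^sup>+x\<in>I. ennreal (staircase n x) \<partial>lborel)"
    using assms by (intro nn_integral_cong)
      (auto simp: I_def m staircase_eq_1 split: split_indicator)
  also have "\<dots> = emeasure (staircase_measure n) (carleson_square I)"
    using lI by (subst emeasure_carleson_square_staircase_measure) (auto simp: I_def m_def)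
  also have "\<dots> \<le> ennreal (C * 2 powi m)" using C I lI by auto
  finally have "1 \<le> C" using C by simp
  then show "1 \<le> ennreal C" by simp
qed

section \<open>Smallness for large n\<close>

theorem theorem2p2:
  fixes \<epsilon> :: real
  assumes "\<epsilon> > 0"
  shows "\<exists>\<mu> :: (real \<times> real) measure.
           carleson_measure \<mu> \<and> Carl \<mu> = 1 \<and>
           (AE t in lborel. dyadic_balayage \<mu> t < \<infinity>) \<and>
           (\<lambda>t. enn2real (dyadic_balayage \<mu> t)) \<in> BMO \<and>
           BMO_norm (\<lambda>t. enn2real (dyadic_balayage \<mu> t)) +
             ennreal (L2_norm (\<lambda>t. enn2real (dyadic_balayage \<mu> t))) < ennreal \<epsilon>"
proof -
  \<comment> \<open>The two summands are the bounds for the BMO norm and the L^2 norm of the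
    staircase; both tend to 0, while the Carleson constant stays 1 for every n > 0.\<close>
  have "(\<lambda>n. 10 / real n + sqrt (2 * (1/2)^n)) \<longlonglongrightarrow> 0 + sqrt (2 * 0)"
    by (intro tendsto_intros LIMSEQ_power_zero lim_const_over_n) simp
  then have "eventually (\<lambda>n. 10 / real n + sqrt (2 * (1/2)^n) < \<epsilon>) sequentially"
    using assms by (intro order_tendstoD(2)) auto
  then obtain n where n: "0 < n" "10 / real n + sqrt (2 * (1/2)^n) < \<epsilon>"
    using eventually_conj[OF eventually_gt_at_top[of 0]] eventually_happens'[OF sequentially_bot] by blast
  note bmo = BMO_norm_staircase_le[OF n(1)]
  have "BMO_norm (staircase n) + ennreal (L2_norm (staircase n)) \<le>
      ennreal (10 / n) + ennreal (sqrt (2 * (1/2)^n))"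
    by (intro add_mono bmo ennreal_leI L2_norm_staircase_le)
  also have "\<dots> < ennreal \<epsilon>"
    using n by (simp add: ennreal_less_iff flip: ennreal_plus)
  finally have small: "BMO_norm (staircase n) + ennreal (L2_norm (staircase n)) < ennreal \<epsilon>" .
  have "staircase n \<in> BMO"
    using bmo integrable_staircase_square[of n] by (auto simp: BMO_def L2_def intro: le_less_trans)
  \<comment> \<open>The balayage equals the staircase at every point, hence is finite everywhere,
    and \<open>enn2real\<close> recovers the nonnegative staircase.\<close>
  then show ?thesis
    using small carleson_measure_staircase_measure[of n] Carl_staircase_measure[OF n(1)]
    by (intro exI[of _ "staircase_measure n"]) (simp add: dyadic_balayage_staircase_measure staircase_nonneg)
qed

end
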